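(* Let $\alpha\ge 3$, $\beta>0$, $t_0>0$, let $\Phi:\mathcal H\to\mathbb R$ be a twice continuously differentiable convex function with $\operatorname{argmin}\Phi\neq\emptyset$, and let $x:[t_0,+\infty[\to\mathcal H$ be a solution of $$\ddot x(t)+\frac{\alpha}{t}\dot x(t)+\beta\nabla^2\Phi(x(t))\dot x(t)+\nabla\Phi(x(t))=0 .$$ Then $$\int_{t_0}^\infty t^2\|\nabla\Phi(x(t))\|^2\,dt<+\infty\qquad\text{and}\qquad \|\dot x(t)+\beta\nabla\Phi(x(t))\|=\mathcal O\left(\frac1t\right)\ \text{ as } t\to+\infty.$$ If, moreover, $\nabla\Phi$ is Lipschitz continuous on bounded sets, then $\|\ddot x(t)\|=\mathcal O\left(\frac{1}{\sqrt{\ln t}}\right)$ as $t\to+\infty$.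
   Context: $\mathcal H$ is a real Hilbert space with norm $\|\cdot\|$. A solution $x$ of the differential equation is a twice continuously differentiable function satisfying it for all $t\ge t_0$. *)

theory Defs
  imports "HOL-Analysis.Analysis" "HOL-Library.Landau_Symbols"
begin

definition gradient :: "('a::real_inner \<Rightarrow> real) \<Rightarrow> 'a \<Rightarrow> 'a" where
  "gradient f z = (THE D. GDERIV f z :> D)"

(* The Hessian is the Frechet derivative of the gradient, as a bounded linear operator. *)
definition hessian :: "('a::real_inner \<Rightarrow> real) \<Rightarrow> 'a \<Rightarrow> 'a \<Rightarrow>\<^sub>L 'a" where
  "hessian f z = Blinfun (frechet_derivative (gradient f) (at z))"

(* On a Hilbert space, by the Riesz representation, existence of a gradient is the same as
   Frechet differentiability.  Continuity of the Hessian is with respect to the operator norm. *)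
definition twice_continuously_differentiable :: "('a::real_inner \<Rightarrow> real) \<Rightarrow> bool" where
  "twice_continuously_differentiable f \<longleftrightarrow>
     (\<forall>z. \<exists>D. GDERIV f z :> D) \<and>
     (\<forall>z. gradient f differentiable (at z)) \<and>
     continuous_on UNIV (hessian f)"

definition argmin :: "('a \<Rightarrow> real) \<Rightarrow> 'a set" where
  "argmin f = {z. is_arg_min f (\<lambda>_. True) z}"

(* Curves live on [t0, +oo[: the derivative at t0 is one-sided, and values of the
   function to the left of t0 are irrelevant. *)
definition time_deriv :: "real \<Rightarrow> (real \<Rightarrow> 'a::real_normed_vector) \<Rightarrow> real \<Rightarrow> 'a" where
  "time_deriv t0 x t = vector_derivative x (at t within {t0..})"

definition C2_curve :: "real \<Rightarrow> (real \<Rightarrow> 'a::real_normed_vector) \<Rightarrow> bool" where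
  "C2_curve t0 x \<longleftrightarrow>
     (\<forall>t\<ge>t0. x differentiable (at t within {t0..})) \<and>
     (\<forall>t\<ge>t0. time_deriv t0 x differentiable (at t within {t0..})) \<and>
     continuous_on {t0..} (time_deriv t0 (time_deriv t0 x))"

definition is_solution ::
  "real \<Rightarrow> real \<Rightarrow> real \<Rightarrow> ('a::real_inner \<Rightarrow> real) \<Rightarrow> (real \<Rightarrow> 'a) \<Rightarrow> bool" where
  "is_solution \<alpha> \<beta> t0 \<Phi> x \<longleftrightarrow>
     C2_curve t0 x \<and>
     (\<forall>t\<ge>t0. time_deriv t0 (time_deriv t0 x) t + (\<alpha> / t) *\<^sub>R time_deriv t0 x t
        + \<beta> *\<^sub>R blinfun_apply (hessian \<Phi> (x t)) (time_deriv t0 x t)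
        + gradient \<Phi> (x t) = 0)"

definition lipschitz_on_bounded_sets ::
  "('a::metric_space \<Rightarrow> 'b::metric_space) \<Rightarrow> bool" where
  "lipschitz_on_bounded_sets F \<longleftrightarrow> (\<forall>B. bounded B \<longrightarrow> (\<exists>L. L-lipschitz_on B F))"

end

(* With z a minimizer and g = grad Phi(x), the vector u = (alpha - 1)(x - z) + t (x' + beta g)
   satisfies u' = (beta - t) g.  Weighting the classical energy |u|^2/2 + t (t - beta)(Phi(x) - Phi(z))
   by t / (t - beta) absorbs the term beta (Phi(x) - Phi(z)) left over in its derivative: for t > beta,
     W = t / (t - beta) |u|^2/2 + t^2 (Phi(x) - Phi(z))   satisfies   W' <= - beta t^2 |g|^2.
   Hence t^2 |g|^2 is integrable, u is bounded and Phi(x) - Phi(z) = O(1/t^2).  Boundedness of u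
   bounds x, and therefore t (x' + beta g).  If the gradient is Lipschitz on bounded sets,
   |g|^2 is controlled by Phi(x) - Phi(z), so g, x' and then x'' are even O(1/t). *)
theory Submission
  imports Defs "HOL-Real_Asymp.Real_Asymp"
begin

section \<open>Convexity, difference quotients and integrability from a decreasing function\<close>

text \<open>By convexity the quotients of \<open>f\<close> along the segment from \<open>y\<close>
  to \<open>w\<close> are at most \<open>f w - f y\<close> for step sizes in ]0,1[. Their limit from
  the right is \<open>D \<bullet> (w - y)\<close>.\<close>

lemma convex_on_gradient_ineq:
  fixes f :: "'a::real_inner \<Rightarrow> real"
  assumes conv: "convex_on UNIV f" and D: "GDERIV f y :> D"
  shows "f y + D \<bullet> (w - y) \<le> f w"
proof -
  let ?p = "\<lambda>s::real. f (y + s *\<^sub>R (w - y))"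
  have "((\<lambda>s::real. y + s *\<^sub>R (w - y)) has_derivative (\<lambda>s. s *\<^sub>R (w - y))) (at 0)"
    by (auto intro!: derivative_eq_intros)
  moreover have "(f has_derivative (\<lambda>h. h \<bullet> D)) (at (y + 0 *\<^sub>R (w - y)))"
    using D by (simp add: gderiv_def)
  ultimately have "(?p has_derivative (\<lambda>s. (s *\<^sub>R (w - y)) \<bullet> D)) (at 0)"
    by (rule has_derivative_compose)
  then have "(?p has_field_derivative (D \<bullet> (w - y))) (at 0)"
    by (simp add: has_field_derivative_def inner_commute mult.commute[of _ "D \<bullet> (w - y)"])
  then have "((\<lambda>s. (?p s - f y) / s) \<longlongrightarrow> D \<bullet> (w - y)) (at_right 0)"
    by (auto simp: has_field_derivative_iff intro: filterlim_mono[OF _ order_refl at_le])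
  moreover have "eventually (\<lambda>s. (?p s - f y) / s \<le> f w - f y) (at_right 0)"
  proof (rule eventually_at_rightI[of 0 1])
    fix s :: real assume s: "s \<in> {0<..<1}"
    have "?p s = f ((1 - s) *\<^sub>R y + s *\<^sub>R w)"
      by (simp add: algebra_simps)
    also have "\<dots> \<le> (1 - s) * f y + s * f w"
      using s by (intro convex_onD[OF conv]) auto
    finally show "(?p s - f y) / s \<le> f w - f y"
      using s by (simp add: field_simps)
  qed simp
  ultimately have "D \<bullet> (w - y) \<le> f w - f y"
    by (intro tendsto_upperbound) auto
  then show ?thesis by simp
qed

text \<open>Compares the limits of the two families of difference quotients. It lets a Lipschitz
  bound along the trajectory control the derivative of \<open>G (x t)\<close> without an operator
  norm estimate for the Hessian.\<close>

lemma norm_vector_derivative_le: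
  fixes f :: "real \<Rightarrow> 'a::real_normed_vector" and g :: "real \<Rightarrow> 'b::real_normed_vector"
  assumes f: "(f has_vector_derivative f') (at t)" and g: "(g has_vector_derivative g') (at t)"
    and le: "eventually (\<lambda>s. norm (f s - f t) \<le> L * norm (g s - g t)) (at t)"
  shows "norm f' \<le> L * norm g'"
proof -
  have lim: "((\<lambda>s. norm (F s - F t) / \<bar>s - t\<bar>) \<longlongrightarrow> norm F') (at t)"
    if "(F has_vector_derivative F') (at t)" for F :: "real \<Rightarrow> 'c::real_normed_vector" and F'
  proof -
    have "((\<lambda>s. (F s - F t) /\<^sub>R (s - t) - F') \<longlongrightarrow> 0) (at t)"
    proof (rule tendsto_norm_zero_cancel)
      have "((\<lambda>s. norm (F s - F t - (s - t) *\<^sub>R F') / norm (s - t)) \<longlongrightarrow> 0) (at t)"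
        using that by (simp add: has_vector_derivative_def has_derivative_iff_norm)
      moreover have "eventually (\<lambda>s. norm (F s - F t - (s - t) *\<^sub>R F') / norm (s - t)
          = norm ((F s - F t) /\<^sub>R (s - t) - F')) (at t)"
      proof (rule eventually_at_filter[THEN iffD2, OF always_eventually], intro allI impI)
        fix s assume "s \<noteq> t"
        then have "(F s - F t) /\<^sub>R (s - t) - F' = (F s - F t - (s - t) *\<^sub>R F') /\<^sub>R (s - t)"
          by (simp add: scaleR_diff_right)
        then show "norm (F s - F t - (s - t) *\<^sub>R F') / norm (s - t)
          = norm ((F s - F t) /\<^sub>R (s - t) - F')"
          by (simp add: divide_inverse mult.commute)
      qed
      ultimately show "((\<lambda>s. norm ((F s - F t) /\<^sub>R (s - t) - F')) \<longlongrightarrow> 0) (at t)"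
        by (rule Lim_transform_eventually)
    qed
    then have "((\<lambda>s. norm ((F s - F t) /\<^sub>R (s - t))) \<longlongrightarrow> norm F') (at t)"
      by (intro tendsto_norm) (simp add: LIM_zero_iff)
    then show ?thesis
      by (simp add: divide_inverse mult.commute)
  qed
  have "((\<lambda>s. L * (norm (g s - g t) / \<bar>s - t\<bar>)) \<longlongrightarrow> L * norm g') (at t)"
    by (intro tendsto_intros lim g)
  moreover have "eventually (\<lambda>s. norm (f s - f t) / \<bar>s - t\<bar>
      \<le> L * (norm (g s - g t) / \<bar>s - t\<bar>)) (at t)"
    using le by eventually_elim (auto simp: divide_right_mono)
  ultimately show ?thesis
    by (intro tendsto_le[OF _ _ lim[OF f]]) auto
qed

lemma inner_self_deriv:
  fixes f :: "real \<Rightarrow> 'a::real_inner"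
  assumes "(f has_vector_derivative f') (at t)"
  shows "((\<lambda>t. f t \<bullet> f t) has_real_derivative 2 * (f t \<bullet> f')) (at t)"
proof -
  have "((\<lambda>t. f t \<bullet> f t) has_vector_derivative (f t \<bullet> f' + f' \<bullet> f t)) (at t)"
    by (rule bounded_bilinear.has_vector_derivative[OF bounded_bilinear_inner assms assms])
  then show ?thesis
    by (simp add: has_real_derivative_iff_has_vector_derivative inner_commute)
qed

text \<open>Integrating \<open>W' \<le> - f\<close> bounds the integral of \<open>f\<close> over
  [T,y] by \<open>W T - W y\<close>, hence by \<open>W T\<close>. The stretch from \<open>a\<close>
  to \<open>T\<close>, where nothing is known about \<open>W\<close>, contributes a finite amount by
  continuity of \<open>f\<close>.\<close>

lemma set_integrable_atLeast_Lyapunov: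
  fixes f W W' :: "real \<Rightarrow> real"
  assumes cont: "continuous_on {a..} f" and f0: "\<And>t. a \<le> t \<Longrightarrow> 0 \<le> f t"
    and aT: "a \<le> T"
    and W: "\<And>t. T \<le> t \<Longrightarrow> (W has_real_derivative W' t) (at t)"
    and le: "\<And>t. T \<le> t \<Longrightarrow> W' t \<le> - f t"
    and W0: "\<And>t. T \<le> t \<Longrightarrow> 0 \<le> W t"
  shows "set_integrable lborel {a..} f"
proof -
  let ?I = "\<lambda>y. integral {a..y} f"
  have int: "f integrable_on {b..y}" if "a \<le> b" for b y
    using that by (intro integrable_continuous_interval continuous_on_subset[OF cont]) auto
  have mono: "mono ?I"
    by (intro monoI integral_subset_le int) (auto intro: f0)
  have bound: "?I y \<le> ?I T + W T" for y
  proof (cases "T \<le> y")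
    case True
    have "((\<lambda>t. - W' t) has_integral (- W y - - W T)) {T..y}"
      using True
      by (intro fundamental_theorem_of_calculus)
        (auto intro!: derivative_eq_intros W[THEN has_field_derivative_at_within]
          simp flip: has_real_derivative_iff_has_vector_derivative)
    then have "integral {T..y} f \<le> - W y - - W T"
      using int[OF aT] le by (intro has_integral_le[OF integrable_integral]) force+
    moreover have "?I y = ?I T + integral {T..y} f"
      using Henstock_Kurzweil_Integration.integral_combine[OF aT True int] by simp
    ultimately show ?thesis using W0[OF True] by simp
  next
    case False
    then show ?thesis using monoD[OF mono, of y T] W0[of T] by simp
  qed
  have "incseq (\<lambda>n. ?I (real n))"
    using mono by (auto simp: incseq_def mono_def)
  then obtain l where "(\<lambda>n. ?I (real n)) \<longlonglongrightarrow> l"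
    using incseq_convergent bound by metis
  then have "(?I \<longlongrightarrow> l) at_top"
    by (rule tendsto_at_topI_sequentially_real[OF mono])
  then have "(f has_integral l) {a..}"
    using int f0 by (intro has_integral_to_inf) auto
  then have "f absolutely_integrable_on {a..}"
    using f0 by (intro nonnegative_absolutely_integrable_1) auto
  then show ?thesis
    \<comment> \<open>Absolute integrability refers to the completed measure; Borel measurability of
      the continuous \<open>f\<close> on \<open>{a..}\<close> brings it back to
      \<open>lborel\<close>.\<close>
    unfolding set_integrable_def
    using borel_measurable_continuous_on_indicator[OF _ cont]
    by (subst integrable_completion[symmetric]) auto
qed

section \<open>Lyapunov analysis of the trajectory for large times\<close>

text \<open>Here \<open>h\<close> stands for the Hessian term, recorded only as the derivative of
  \<open>G (x t)\<close>. Starting at \<open>T > \<beta>\<close> keeps the weight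
  \<open>t / (t - \<beta>)\<close> positive, and \<open>1 \<le> T\<close> allows crude estimates
  such as \<open>\<alpha> / t \<le> \<alpha>\<close>.\<close>

locale damped_trajectory =
  fixes \<Phi> :: "'a::real_inner \<Rightarrow> real" and G :: "'a \<Rightarrow> 'a"
    and x v a h :: "real \<Rightarrow> 'a" and z :: 'a and \<alpha> \<beta> T :: real
  assumes \<alpha>: "3 \<le> \<alpha>" and \<beta>: "0 < \<beta>" and \<beta>_less: "\<beta> < T" and T1: "1 \<le> T"
    and conv: "convex_on UNIV \<Phi>" and G: "\<And>y. GDERIV \<Phi> y :> G y"
    and minimal: "\<And>y. \<Phi> z \<le> \<Phi> y"
    and x: "\<And>t. T \<le> t \<Longrightarrow> (x has_vector_derivative v t) (at t)"
    and v: "\<And>t. T \<le> t \<Longrightarrow> (v has_vector_derivative a t) (at t)"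
    and h: "\<And>t. T \<le> t \<Longrightarrow> ((\<lambda>t. G (x t)) has_vector_derivative h t) (at t)"
    and eq: "\<And>t. T \<le> t \<Longrightarrow> a t + (\<alpha> / t) *\<^sub>R v t + \<beta> *\<^sub>R h t + G (x t) = 0"
begin

lemmas above_tangent = convex_on_gradient_ineq[OF conv G]

definition u :: "real \<Rightarrow> 'a" where
  "u t = (\<alpha> - 1) *\<^sub>R (x t - z) + t *\<^sub>R (v t + \<beta> *\<^sub>R G (x t))"

definition W :: "real \<Rightarrow> real" where
  "W t = t / (t - \<beta>) * (u t \<bullet> u t) / 2 + t\<^sup>2 * (\<Phi> (x t) - \<Phi> z)"

definition W' :: "real \<Rightarrow> real" where
  "W' t = - (\<beta> / (t - \<beta>)\<^sup>2) * (u t \<bullet> u t) / 2 - t * (u t \<bullet> G (x t))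
     + 2 * t * (\<Phi> (x t) - \<Phi> z) + t\<^sup>2 * (v t \<bullet> G (x t))"

text \<open>Multiplying the equation by \<open>t\<close> expresses \<open>t *\<^sub>R a t\<close>
  through the other terms. The velocity terms then cancel, as do the \<open>h\<close> terms, and
  only multiples of \<open>G (x t)\<close> survive.\<close>

lemma u_deriv:
  assumes "T \<le> t" shows "(u has_vector_derivative (\<beta> - t) *\<^sub>R G (x t)) (at t)"
proof -
  have "t > 0" using assms T1 by simp
  have a: "t *\<^sub>R a t = - \<alpha> *\<^sub>R v t - (t * \<beta>) *\<^sub>R h t - t *\<^sub>R G (x t)"
  proof -
    have "t *\<^sub>R (a t + (\<alpha> / t) *\<^sub>R v t + \<beta> *\<^sub>R h t + G (x t)) = 0"
      using eq[OF assms] by simp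
    then have "t *\<^sub>R a t + \<alpha> *\<^sub>R v t + (t * \<beta>) *\<^sub>R h t + t *\<^sub>R G (x t) = 0"
      using \<open>t > 0\<close> by (simp add: scaleR_add_right)
    then show ?thesis
      by (simp add: eq_neg_iff_add_eq_0 algebra_simps)
  qed
  have "(u has_vector_derivative (\<alpha> - 1) *\<^sub>R v t + (t *\<^sub>R (a t + \<beta> *\<^sub>R h t)
      + (v t + \<beta> *\<^sub>R G (x t)))) (at t)"
    unfolding u_def
    by (rule derivative_eq_intros x[OF assms] v[OF assms] h[OF assms] | simp)+
  moreover have "(\<alpha> - 1) *\<^sub>R v t + (t *\<^sub>R (a t + \<beta> *\<^sub>R h t) + (v t + \<beta> *\<^sub>R G (x t)))
      = (\<beta> - t) *\<^sub>R G (x t)"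
    by (simp add: scaleR_add_right a algebra_simps)
  ultimately show ?thesis by simp
qed

lemma \<Phi>_deriv:
  assumes "T \<le> t" shows "((\<lambda>t. \<Phi> (x t)) has_real_derivative v t \<bullet> G (x t)) (at t)"
proof -
  have "((\<lambda>t. \<Phi> (x t)) has_derivative (\<lambda>s. (s *\<^sub>R v t) \<bullet> G (x t))) (at t)"
    using x[OF assms] G[of "x t"] unfolding has_vector_derivative_def gderiv_def
    by (rule has_derivative_compose)
  then show ?thesis
    by (simp add: has_field_derivative_def mult.commute[of _ "v t \<bullet> G (x t)"])
qed

lemma W_deriv:
  assumes "T \<le> t" shows "(W has_real_derivative W' t) (at t)"
proof -
  have "t - \<beta> \<noteq> 0" "t - \<beta> > 0" using assms \<beta>_less by auto
  then have "((\<lambda>t. t / (t - \<beta>)) has_real_derivative - (\<beta> / (t - \<beta>)\<^sup>2)) (at t)"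
    by (auto intro!: derivative_eq_intros simp: field_simps power2_eq_square)
  note q = DERIV_mult[OF this inner_self_deriv[OF u_deriv[OF assms]]]
  have d: "(W has_real_derivative
     (- (\<beta> / (t - \<beta>)\<^sup>2) * (u t \<bullet> u t) + 2 * (u t \<bullet> (\<beta> - t) *\<^sub>R G (x t)) * (t / (t - \<beta>))) / 2
     + (2 * t * (\<Phi> (x t) - \<Phi> z) + (v t \<bullet> G (x t)) * t\<^sup>2)) (at t)"
    unfolding W_def
    by (rule derivative_eq_intros q \<Phi>_deriv[OF assms] refl | simp)+
  \<comment> \<open>The weight is designed for this cancellation: its denominator
    \<open>t - \<beta>\<close> meets the factor \<open>\<beta> - t\<close> of the derivative of
    \<open>u\<close> and leaves \<open>- t\<close>.\<close>
  have eq: "2 * (u t \<bullet> (\<beta> - t) *\<^sub>R G (x t)) * (t / (t - \<beta>)) = - 2 * (t * (u t \<bullet> G (x t)))"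
    using \<open>t - \<beta> \<noteq> 0\<close> unfolding inner_scaleR_right by (simp add: field_simps)
  have "(- (\<beta> / (t - \<beta>)\<^sup>2) * (u t \<bullet> u t)
        + 2 * (u t \<bullet> (\<beta> - t) *\<^sub>R G (x t)) * (t / (t - \<beta>))) / 2
      + (2 * t * (\<Phi> (x t) - \<Phi> z) + (v t \<bullet> G (x t)) * t\<^sup>2) = W' t"
    unfolding eq W'_def by (simp add: add_divide_distrib mult.commute)
  with d show ?thesis by simp
qed

text \<open>Expanding \<open>u \<bullet> G\<close> cancels the term in \<open>v \<bullet> G\<close>
  and produces the wanted multiple of |G|^2. The positive term with the value gap is absorbed by
  \<open>(\<alpha> - 1) * ?q\<close>, since \<open>\<alpha> - 1 \<ge> 2\<close> and convexity gives
  \<open>?p \<le> ?q\<close>.\<close>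

lemma W'_le:
  assumes "T \<le> t" shows "W' t \<le> - (\<beta> * (t\<^sup>2 * (norm (G (x t)))\<^sup>2))"
proof -
  have t: "t > 0" using assms T1 by simp
  let ?p = "\<Phi> (x t) - \<Phi> z" and ?q = "(x t - z) \<bullet> G (x t)"
  have pq: "?p \<le> ?q"
    using above_tangent[of "x t" z] by (simp add: inner_diff_left inner_diff_right inner_commute)
  have "2 * ?p \<le> (\<alpha> - 1) * ?p"
    using \<alpha> minimal[of "x t"] by (intro mult_right_mono) auto
  also have "\<dots> \<le> (\<alpha> - 1) * ?q"
    using \<alpha> pq by (intro mult_left_mono) auto
  finally have "2 * t * ?p \<le> t * ((\<alpha> - 1) * ?q)"
    using t by (simp add: mult.assoc mult.left_commute[of 2 t])
  moreover have "(\<beta> / (t - \<beta>)\<^sup>2) * (u t \<bullet> u t) / 2 \<ge> 0"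
    using \<beta> by simp
  moreover have "u t \<bullet> G (x t) = (\<alpha> - 1) * ?q + t * (v t \<bullet> G (x t)) + t * \<beta> * (norm (G (x t)))\<^sup>2"
    by (simp add: u_def inner_add_left power2_norm_eq_inner algebra_simps)
  then have "t * (u t \<bullet> G (x t)) = t * ((\<alpha> - 1) * ?q) + t\<^sup>2 * (v t \<bullet> G (x t))
      + \<beta> * (t\<^sup>2 * (norm (G (x t)))\<^sup>2)"
    by (simp add: power2_eq_square distrib_left mult_ac)
  ultimately show ?thesis
    unfolding W'_def by linarith
qed

lemma W_nonneg:
  assumes "T \<le> t" shows "0 \<le> W t"
  using assms \<beta>_less T1 minimal[of "x t"] by (simp add: W_def)

lemma W_le:
  assumes "T \<le> t" shows "W t \<le> W T"
proof (rule DERIV_nonpos_imp_nonincreasing[OF assms])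
  fix s assume "T \<le> s"
  moreover have "W' s \<le> 0"
    using W'_le[OF \<open>T \<le> s\<close>] \<beta> by (smt (verit) mult_nonneg_nonneg zero_le_power2)
  ultimately show "\<exists>y. (W has_real_derivative y) (at s) \<and> y \<le> 0"
    using W_deriv by blast
qed

lemma value_gap_bound:
  assumes "T \<le> t" shows "t\<^sup>2 * (\<Phi> (x t) - \<Phi> z) \<le> W T"
proof -
  have "0 \<le> t / (t - \<beta>) * (u t \<bullet> u t) / 2"
    using assms \<beta>_less T1 by simp
  then show ?thesis using W_le[OF assms] unfolding W_def by linarith
qed

lemma u_bound:
  assumes "T \<le> t" shows "u t \<bullet> u t \<le> 2 * W T"
proof -
  \<comment> \<open>The weight is at least 1, so it may be inserted for free.\<close>
  have "u t \<bullet> u t \<le> t / (t - \<beta>) * (u t \<bullet> u t)"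
    using assms \<beta>_less \<beta> mult_right_mono[of 1 "t / (t - \<beta>)" "u t \<bullet> u t"] by simp
  also have "\<dots> = 2 * (t / (t - \<beta>) * (u t \<bullet> u t) / 2)"
    by (simp only: mult_2 field_sum_of_halves)
  also have "\<dots> \<le> 2 * W t"
    unfolding W_def using minimal[of "x t"] by (intro mult_left_mono) auto
  also have "\<dots> \<le> 2 * W T" using W_le[OF assms] by simp
  finally show ?thesis .
qed

lemma norm_u_bound:
  assumes "T \<le> t" shows "norm (u t) \<le> sqrt (2 * W T)"
  using u_bound[OF assms] by (simp add: norm_eq_sqrt_inner)

text \<open>With \<open>f = |x - z|\<^sup>2\<close>, the pairing \<open>u \<bullet> (x - z)\<close> gives \<open>t f' + 3 f \<le> |u|\<^sup>2\<close>,
  so that \<open>t (f - 2 W T)\<close> is nonincreasing.\<close>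
lemma x_bounded: "\<exists>R. \<forall>t\<ge>T. norm (x t - z) \<le> R"
proof -
  define f where "f t = (x t - z) \<bullet> (x t - z)" for t
  define k where "k t = t * (f t - 2 * W T)" for t
  have f_nonneg: "0 \<le> f t" for t by (simp add: f_def)
  have k_le: "k t \<le> k T" if "T \<le> t" for t
  proof (rule DERIV_nonpos_imp_nonincreasing[OF that])
    fix s assume s: "T \<le> s"
    let ?d = "(x s - z) \<bullet> v s"
    have "(f has_real_derivative 2 * ?d) (at s)"
      unfolding f_def using x[OF s] by (intro inner_self_deriv) (auto intro!: derivative_eq_intros)
    then have "(k has_real_derivative f s - 2 * W T + s * (2 * ?d)) (at s)"
      unfolding k_def by (auto intro!: derivative_eq_intros)
    moreover have "f s - 2 * W T + s * (2 * ?d) \<le> 0"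
    proof -
      have "0 \<le> (x s - z) \<bullet> G (x s)"
        using above_tangent[of "x s" z] minimal[of "x s"]
        by (simp add: inner_diff_left inner_diff_right inner_commute)
      then have "0 \<le> s * \<beta> * ((x s - z) \<bullet> G (x s))"
        using s T1 \<beta> by simp
      moreover have "(x s - z) \<bullet> u s = (\<alpha> - 1) * f s + s * ?d + s * \<beta> * ((x s - z) \<bullet> G (x s))"
        by (simp add: u_def f_def inner_add_right algebra_simps)
      moreover have "2 * f s \<le> (\<alpha> - 1) * f s"
        using \<alpha> f_nonneg by (intro mult_right_mono) auto
      \<comment> \<open>Young's inequality for \<open>(x s - z) \<bullet> u s\<close>, obtained from
        a square.\<close>
      moreover have "0 \<le> (u s - (x s - z)) \<bullet> (u s - (x s - z))" by simp
      then have "2 * ((x s - z) \<bullet> u s) \<le> u s \<bullet> u s + f s"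
        by (simp add: f_def inner_diff_left[of "u s"]
            inner_diff_right[of _ "u s"] inner_commute[of "u s" "x s - z"])
      ultimately show ?thesis
        using u_bound[OF s] f_nonneg[of s] by linarith
    qed
    ultimately show "\<exists>y. (k has_real_derivative y) (at s) \<and> y \<le> 0" by blast
  qed
  \<comment> \<open>From \<open>k t \<le> k T\<close> and \<open>t \<ge> 1\<close> follows
    \<open>f t \<le> 2 * W T + \<bar>k T\<bar>\<close>. The extra 1 gives R <= R^2, so the same
    \<open>R\<close> bounds the square root of \<open>f t\<close>.\<close>
  define R where "R = 2 * W T + \<bar>k T\<bar> + 1"
  have R: "1 \<le> R" using W_nonneg[of T] by (simp add: R_def)
  have "norm (x t - z) \<le> R" if t: "T \<le> t" for t
  proof -
    have "t * (f t - 2 * W T) \<le> t * \<bar>k T\<bar>"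
    proof -
      have "k T \<le> t * \<bar>k T\<bar>"
        using t T1 by (smt (verit) mult_left_le_one_le mult_le_cancel_right1)
      then show ?thesis using k_le[OF t] by (simp add: k_def)
    qed
    then have "f t \<le> R"
      using t T1 by (simp add: R_def)
    also have "\<dots> \<le> R\<^sup>2" using R by (simp add: power2_eq_square)
    finally show ?thesis
      using R by (simp add: f_def norm_eq_sqrt_inner real_le_lsqrt)
  qed
  then show ?thesis by blast
qed

text \<open>Solving the definition of \<open>u\<close> for
  \<open>t *\<^sub>R (v t + \<beta> *\<^sub>R G (x t))\<close> leaves a difference of two bounded
  terms.\<close>

lemma velocity_bound: "\<exists>C. \<forall>t\<ge>T. norm (v t + \<beta> *\<^sub>R G (x t)) \<le> C / t"
proof -
  obtain R where R: "\<And>t. T \<le> t \<Longrightarrow> norm (x t - z) \<le> R"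
    using x_bounded by blast
  define C where "C = sqrt (2 * W T) + (\<alpha> - 1) * R"
  have "norm (v t + \<beta> *\<^sub>R G (x t)) \<le> C / t" if t: "T \<le> t" for t
  proof -
    have "t * norm (v t + \<beta> *\<^sub>R G (x t)) = norm (t *\<^sub>R (v t + \<beta> *\<^sub>R G (x t)))"
      using t T1 by simp
    also have "t *\<^sub>R (v t + \<beta> *\<^sub>R G (x t)) = u t - (\<alpha> - 1) *\<^sub>R (x t - z)"
      by (simp add: u_def)
    also have "norm \<dots> \<le> norm (u t) + norm ((\<alpha> - 1) *\<^sub>R (x t - z))"
      by (rule norm_triangle_ineq4)
    also have "\<dots> \<le> sqrt (2 * W T) + (\<alpha> - 1) * R"
      using norm_u_bound[OF t] R[OF t] \<alpha> by (intro add_mono) (auto intro: mult_left_mono)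
    finally show ?thesis using t T1 by (simp add: C_def field_simps)
  qed
  then show ?thesis by blast
qed

text \<open>The equation gives \<open>a\<close> in terms of \<open>v\<close>, \<open>h\<close> and
  \<open>G (x t)\<close>, so each of these is shown to be O(1/t). The key is |G|^2 <= 4 L (value
  gap), which turns the O(1/t^2) decay of the gap into O(1/t) for the gradient.\<close>

lemma acceleration_bound:
  assumes lip: "lipschitz_on_bounded_sets G"
  shows "\<exists>C. \<forall>t>T. norm (a t) \<le> C / t"
proof -
  let ?X = "x ` {T..}"
  obtain R where R: "\<And>t. T \<le> t \<Longrightarrow> norm (x t - z) \<le> R"
    using x_bounded by blast
  then have X: "bounded ?X"
    by (intro boundedI[of _ "norm z + R"])
      (auto, metis add.commute diff_add_cancel norm_triangle_ineq add_left_mono order_trans)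
  then obtain M where M: "\<And>t. T \<le> t \<Longrightarrow> norm (x t) \<le> M"
    unfolding bounded_iff by auto
  \<comment> \<open>A first Lipschitz constant, on the trajectory alone, serves only to bound
    \<open>G\<close> there and so to make the larger set \<open>S\<close> bounded.\<close>
  obtain L1 where L1: "L1-lipschitz_on ?X G"
    using lip X unfolding lipschitz_on_bounded_sets_def by blast
  define B where "B = norm (G (x T)) + L1 * (M + M)"
  have B: "norm (G (x t)) \<le> B" if t: "T \<le> t" for t
  proof -
    have "norm (G (x t) - G (x T)) \<le> L1 * norm (x t - x T)"
      using lipschitz_onD[OF L1, of "x t" "x T"] t by (simp add: dist_norm)
    also have "\<dots> \<le> L1 * (M + M)"
      using lipschitz_on_nonneg[OF L1] M[OF t] M[of T] norm_triangle_ineq4[of "x t" "x T"]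
      by (intro mult_left_mono) auto
    finally show ?thesis
      using norm_triangle_sub[of "G (x t)" "G (x T)"] by (simp add: B_def)
  qed
  \<comment> \<open>\<open>S\<close> holds the trajectory (\<open>s = 0\<close>) and every gradient
    step of length factor up to 1 from it. It is fixed before \<open>L\<close> is known, which
    avoids circularity: the step actually used depends on \<open>L\<close>.\<close>
  define S where "S = {x t - s *\<^sub>R G (x t) |t s. T \<le> t \<and> 0 \<le> s \<and> s \<le> 1}"
  have "bounded S"
  proof (rule boundedI)
    fix y assume "y \<in> S"
    then obtain t s where ts: "T \<le> t" "0 \<le> s" "s \<le> 1" "y = x t - s *\<^sub>R G (x t)"
      by (auto simp: S_def)
    have "norm y \<le> norm (x t) + s * norm (G (x t))"
      using norm_triangle_ineq4[of "x t" "s *\<^sub>R G (x t)"] ts by simp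
    also have "\<dots> \<le> M + 1 * B"
      using ts M B by (intro add_mono mult_mono) auto
    finally show "norm y \<le> M + B" by simp
  qed
  then obtain L0 where "L0-lipschitz_on S G"
    using lip unfolding lipschitz_on_bounded_sets_def by blast
  then have lipS: "(max L0 1)-lipschitz_on S G"
    by (rule lipschitz_on_le) simp
  \<comment> \<open>The maximum with 1 ensures that the factor \<open>1 / (2 * L)\<close> is at most
    1, so that the step stays in \<open>S\<close>.\<close>
  define L where "L = max L0 1"
  have lipS: "norm (G p - G q) \<le> L * norm (p - q)" if "p \<in> S" "q \<in> S" for p q
    using lipschitz_onD[OF lipS that] by (auto simp: L_def dist_norm)
  have L: "1 \<le> L" by (simp add: L_def)
  have XS: "x t \<in> S" if "T \<le> t" for t
    using that unfolding S_def by (intro CollectI exI[of _ t] exI[of _ 0]) auto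
  text \<open>One gradient step of length \<open>1/(2L)\<close> decreases \<open>\<Phi>\<close> by at least \<open>|G|\<^sup>2/(4L)\<close>.\<close>
  have descent: "(norm (G (x t)))\<^sup>2 \<le> 4 * L * (\<Phi> (x t) - \<Phi> z)" if t: "T \<le> t" for t
  proof -
    define s where "s = 1 / (2 * L)"
    have s: "0 < s" "s \<le> 1" using L by (auto simp: s_def field_simps)
    let ?g = "G (x t)" and ?y = "x t - s *\<^sub>R G (x t)"
    have "?y \<in> S" unfolding S_def using t s by (blast intro: less_imp_le)
    then have "norm (G ?y - ?g) \<le> L * norm (?y - x t)"
      using XS[OF t] by (intro lipS)
    also have "\<dots> = norm ?g / 2"
      using s L by (simp add: s_def)
    finally have d: "norm (G ?y - ?g) \<le> norm ?g / 2" .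
    \<comment> \<open>The gradient at \<open>?y\<close> differs from \<open>?g\<close> by at most
      half the norm of \<open>?g\<close>, so its component along \<open>?g\<close> keeps at least
      half the size.\<close>
    have "- ((G ?y - ?g) \<bullet> ?g) \<le> norm (G ?y - ?g) * norm ?g"
      using Cauchy_Schwarz_ineq2[of "G ?y - ?g" ?g] by linarith
    also have "\<dots> \<le> norm ?g / 2 * norm ?g"
      using d by (intro mult_right_mono) auto
    finally have "(norm ?g)\<^sup>2 / 2 \<le> G ?y \<bullet> ?g"
      by (simp add: inner_diff_left power2_norm_eq_inner[symmetric] power2_eq_square)
    then have "s * ((norm ?g)\<^sup>2 / 2) \<le> s * (G ?y \<bullet> ?g)"
      using s by (intro mult_left_mono) auto
    \<comment> \<open>The tangent is taken at the new point \<open>?y\<close> and evaluated at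
      \<open>x t\<close>, where the displacement is \<open>s *\<^sub>R ?g\<close>.\<close>
    also have "\<dots> \<le> \<Phi> (x t) - \<Phi> ?y"
      using above_tangent[of ?y "x t"] by simp
    also have "\<dots> \<le> \<Phi> (x t) - \<Phi> z"
      using minimal by simp
    finally show ?thesis using L by (simp add: s_def field_simps)
  qed
  define K where "K = sqrt (4 * L * W T)"
  have g: "norm (G (x t)) \<le> K / t" if t: "T \<le> t" for t
  proof -
    have "(t * norm (G (x t)))\<^sup>2 \<le> t\<^sup>2 * (4 * L * (\<Phi> (x t) - \<Phi> z))"
      using descent[OF t] by (simp add: power_mult_distrib mult_left_mono)
    also have "\<dots> = 4 * L * (t\<^sup>2 * (\<Phi> (x t) - \<Phi> z))" by simp
    also have "\<dots> \<le> 4 * L * W T"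
      using value_gap_bound[OF t] L by (intro mult_left_mono) auto
    finally have "t * norm (G (x t)) \<le> K"
      unfolding K_def by (rule real_le_rsqrt)
    then show ?thesis using t T1 by (simp add: field_simps)
  qed
  obtain C where C: "\<And>t. T \<le> t \<Longrightarrow> norm (v t + \<beta> *\<^sub>R G (x t)) \<le> C / t"
    using velocity_bound by blast
  have vel: "norm (v t) \<le> (C + \<beta> * K) / t" if t: "T \<le> t" for t
  proof -
    have "norm (v t) \<le> norm (v t + \<beta> *\<^sub>R G (x t)) + \<beta> * norm (G (x t))"
      using norm_triangle_ineq4[of "v t + \<beta> *\<^sub>R G (x t)" "\<beta> *\<^sub>R G (x t)"] \<beta> by simp
    also have "\<dots> \<le> C / t + \<beta> * (K / t)"
      using C[OF t] g[OF t] \<beta> by (intro add_mono mult_left_mono) auto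
    finally show ?thesis by (simp add: add_divide_distrib)
  qed
  \<comment> \<open>For \<open>t > T\<close> strictly, all nearby times also lie beyond
    \<open>T\<close>, so both points of the difference quotient belong to \<open>S\<close>.\<close>
  have hess: "norm (h t) \<le> L * norm (v t)" if t: "T < t" for t
  proof (rule norm_vector_derivative_le)
    show "eventually (\<lambda>s. norm (G (x s) - G (x t)) \<le> L * norm (x s - x t)) (at t)"
      by (rule eventually_at_in_open'[of "{T<..}", THEN eventually_mono])
        (use t in \<open>auto intro!: lipS XS\<close>)
  qed (use t in \<open>auto intro: x h\<close>)
  define D where "D = C + \<beta> * K"
  have "norm (a t) \<le> (\<alpha> * D + \<beta> * L * D + K) / t" if t: "T < t" for t
  proof -
    have "t > 0" using t T1 by simp
    have "a t = - ((\<alpha> / t) *\<^sub>R v t + \<beta> *\<^sub>R h t + G (x t))"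
      using eq[of t] t by (simp add: eq_neg_iff_add_eq_0 algebra_simps)
    then have "norm (a t) = norm ((\<alpha> / t) *\<^sub>R v t + \<beta> *\<^sub>R h t + G (x t))"
      by (simp only: norm_minus_cancel)
    also have "\<dots> \<le> norm ((\<alpha> / t) *\<^sub>R v t) + norm (\<beta> *\<^sub>R h t) + norm (G (x t))"
      by (intro norm_triangle_le add_mono) auto
    also have "\<dots> = (\<alpha> / t) * norm (v t) + \<beta> * norm (h t) + norm (G (x t))"
      using \<alpha> \<beta> \<open>t > 0\<close> by simp
    also have "\<dots> \<le> \<alpha> * norm (v t) + \<beta> * (L * norm (v t)) + norm (G (x t))"
      using \<alpha> \<beta> t T1 hess[OF t]
      by (intro add_mono mult_left_mono mult_right_mono) (auto simp: field_simps)
    also have "\<dots> \<le> \<alpha> * (D / t) + \<beta> * (L * (D / t)) + K / t"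
      using \<alpha> \<beta> L t vel[of t] g[of t] by (intro add_mono mult_left_mono) (auto simp: D_def)
    finally show ?thesis by (simp add: add_divide_distrib mult.assoc)
  qed
  then show ?thesis by blast
qed

end

section \<open>Linking the formal definitions to the derivatives of the abstract setting\<close>

text \<open>Uniqueness makes the definite description in \<open>gradient\<close> denote the actual
  gradient.\<close>

lemma GDERIV_unique:
  assumes "GDERIV f y :> D" "GDERIV f y :> E" shows "D = E"
proof -
  have "(\<lambda>h. h \<bullet> D) = (\<lambda>h. h \<bullet> E)"
    using assms unfolding gderiv_def by (rule has_derivative_unique)
  then show ?thesis
    by (metis vector_eq_ldot)
qed

lemma GDERIV_gradient:
  assumes "twice_continuously_differentiable f"
  shows "GDERIV f y :> gradient f y"
  using assms unfolding twice_continuously_differentiable_def gradient_def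
  by (metis GDERIV_unique theI)

text \<open>\<open>Blinfun\<close> loses nothing here because a Frechet derivative is bounded and
  linear.\<close>

lemma gradient_has_derivative_hessian:
  assumes "twice_continuously_differentiable f"
  shows "(gradient f has_derivative blinfun_apply (hessian f y)) (at y)"
proof -
  have "(gradient f has_derivative frechet_derivative (gradient f) (at y)) (at y)"
    using assms unfolding twice_continuously_differentiable_def frechet_derivative_works by blast
  then show ?thesis
    unfolding hessian_def
    by (simp add: bounded_linear_Blinfun_apply has_derivative_bounded_linear)
qed

text \<open>Past \<open>t0\<close> the point is interior, so the derivative within
  \<open>{t0..}\<close> is an ordinary two-sided one.\<close>

lemma differentiable_has_time_deriv:
  assumes "x differentiable (at t within {t0..})" and "t0 < t"
  shows "(x has_vector_derivative time_deriv t0 x t) (at t)"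
proof -
  have "at t within {t0..} = at t"
    using assms(2) by (intro at_within_interior) simp
  then show ?thesis
    using assms(1) vector_derivative_works[of x "at t"] by (simp add: time_deriv_def)
qed

lemma C2_curve_derivs:
  assumes "C2_curve t0 x" and "t0 < t"
  shows "(x has_vector_derivative time_deriv t0 x t) (at t)"
    and "(time_deriv t0 x has_vector_derivative time_deriv t0 (time_deriv t0 x) t) (at t)"
  using assms by (auto simp: C2_curve_def intro!: differentiable_has_time_deriv)

theorem proposition1p11:
  fixes \<Phi> :: "'a::{real_inner, complete_space} \<Rightarrow> real"
    and x :: "real \<Rightarrow> 'a"
    and \<alpha> \<beta> t0 :: real
  assumes "\<alpha> \<ge> 3" and "\<beta> > 0" and "t0 > 0"
    and "twice_continuously_differentiable \<Phi>"
    and "convex_on UNIV \<Phi>"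
    and "argmin \<Phi> \<noteq> {}"
    and "is_solution \<alpha> \<beta> t0 \<Phi> x"
  shows "set_integrable lborel {t0..} (\<lambda>t. t\<^sup>2 * (norm (gradient \<Phi> (x t)))\<^sup>2)
    \<and> (\<lambda>t. norm (time_deriv t0 x t + \<beta> *\<^sub>R gradient \<Phi> (x t))) \<in> O[at_top](\<lambda>t. 1 / t)
    \<and> (lipschitz_on_bounded_sets (gradient \<Phi>) \<longrightarrow>
         (\<lambda>t. norm (time_deriv t0 (time_deriv t0 x) t)) \<in> O[at_top](\<lambda>t. 1 / sqrt (ln t)))"
proof -
  obtain z where z: "\<And>y. \<Phi> z \<le> \<Phi> y"
    using assms(6) by (auto simp: argmin_def is_arg_min_def not_less)
  let ?v = "time_deriv t0 x" and ?G = "gradient \<Phi>"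
  let ?a = "time_deriv t0 ?v" and ?h = "\<lambda>t. blinfun_apply (hessian \<Phi> (x t)) (time_deriv t0 x t)"
  \<comment> \<open>Each summand secures one requirement: two-sided derivatives, positivity of
    \<open>t - \<beta>\<close>, and \<open>T \<ge> 1\<close>.\<close>
  define T where "T = t0 + \<beta> + 1"
  have T: "t0 < T" "1 \<le> T" "\<beta> < T" using assms(2,3) by (auto simp: T_def)
  have C2: "C2_curve t0 x" using assms(7) by (simp add: is_solution_def)
  have h: "((\<lambda>t. ?G (x t)) has_vector_derivative ?h t) (at t)" if "T \<le> t" for t
  proof -
    have "t0 < t" using that T by simp
    from C2_curve_derivs(1)[OF C2 this]
    have "(x has_derivative (\<lambda>s. s *\<^sub>R ?v t)) (at t)"
      by (simp add: has_vector_derivative_def)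
    from has_derivative_compose[OF this gradient_has_derivative_hessian[OF assms(4)]]
    show ?thesis
      by (simp add: has_vector_derivative_def blinfun.scaleR_right)
  qed
  interpret damped_trajectory \<Phi> ?G x ?v ?a ?h z \<alpha> \<beta> T
  proof
    show "GDERIV \<Phi> y :> ?G y" for y by (rule GDERIV_gradient[OF assms(4)])
    show "(x has_vector_derivative ?v t) (at t)" "(?v has_vector_derivative ?a t) (at t)"
      if "T \<le> t" for t
      using C2_curve_derivs[OF C2, of t] that T by auto
    show "?a t + (\<alpha> / t) *\<^sub>R ?v t + \<beta> *\<^sub>R ?h t + ?G (x t) = 0" if "T \<le> t" for t
      using assms(7) that T by (auto simp: is_solution_def)
  qed (fact assms T z h)+
  have "continuous_on {t0..} x"
    using C2 unfolding C2_curve_def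
    by (auto simp: continuous_on_eq_continuous_within intro!: differentiable_imp_continuous_within)
  moreover have "continuous_on UNIV ?G"
    using gradient_has_derivative_hessian[OF assms(4)]
    by (intro continuous_at_imp_continuous_on ballI has_derivative_continuous)
  ultimately have Gx: "continuous_on {t0..} (\<lambda>t. ?G (x t))"
    by (auto intro: continuous_on_compose2)
  \<comment> \<open>The factor \<beta> matches the decay rate of \<open>W\<close>; being nonzero, it
    is divided out next.\<close>
  have "set_integrable lborel {t0..} (\<lambda>t. \<beta> * (t\<^sup>2 * (norm (?G (x t)))\<^sup>2))"
    using T W_deriv W'_le W_nonneg assms(2)
    by (intro set_integrable_atLeast_Lyapunov[of t0 _ T W W'] continuous_intros Gx) auto
  then have "set_integrable lborel {t0..} (\<lambda>t. t\<^sup>2 * (norm (?G (x t)))\<^sup>2)"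
    using assms(2) by simp
  moreover have "(\<lambda>t. norm (?v t + \<beta> *\<^sub>R ?G (x t))) \<in> O[at_top](\<lambda>t. 1 / t)"
  proof -
    obtain C where C: "\<And>t. T \<le> t \<Longrightarrow> norm (?v t + \<beta> *\<^sub>R ?G (x t)) \<le> C / t"
      using velocity_bound by blast
    show ?thesis
      using C T by (intro bigoI[of _ C] eventually_at_top_linorderI[of T]) auto
  qed
  moreover have "(\<lambda>t. norm (?a t)) \<in> O[at_top](\<lambda>t. 1 / sqrt (ln t))"
    if lip: "lipschitz_on_bounded_sets ?G"
  proof -
    obtain C where C: "\<And>t. T < t \<Longrightarrow> norm (?a t) \<le> C / t"
      using acceleration_bound[OF lip] by blast
    \<comment> \<open>The rate obtained is 1/t, stronger than the one claimed. The threshold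
      \<open>T + 1\<close> respects the strict inequality in the bound.\<close>
    have "(\<lambda>t. norm (?a t)) \<in> O[at_top](\<lambda>t. 1 / t)"
      using C T by (intro bigoI[of _ C] eventually_at_top_linorderI[of "T + 1"]) auto
    also have "(\<lambda>t::real. 1 / t) \<in> O[at_top](\<lambda>t. 1 / sqrt (ln t))"
      by real_asymp
    finally show ?thesis .
  qed
  ultimately show ?thesis by blast
qed

end
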